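(* If $z^*=(x^*,y^* )$ is an optimal solution (global minimizer) of the problem $\min\{f(z): z\in F\}$, then $z^*$ is an $N^B$-stationary point of this problem, and $z^*$ is also a $T^B$-stationary point of this problem.
   Context: $l,m,n,s,t$ are positive integers with $s<m$, $t<n$; $\mathscr{A}=(a_{ijk})\in\mathbb{R}^{l\times m\times n}$ and $b\in\mathbb{R}^l$ are given. For $x\in\mathbb{R}^m$, $y\in\mathbb{R}^n$, $\mathscr{A}xy\in\mathbb{R}^l$ has entries $(\mathscr{A}xy)_i=\sum_{j,k}a_{ijk}x_jy_k$, and $f(z)=f(x,y)=\frac12\|\mathscr{A}xy-b\|^2$ for $z=(x,y)\in\mathbb{R}^{m+n}$. $\|\cdot\|_0$ counts nonzero entries. For $x\ne0$, $\gamma_x$ is the index of the first nonzero entry of $x$. $F_1=\{x\in\mathbb{R}^m:\|x\|_0\le s,\ e_{\gamma_x}^\top x=1\}$ (nonzero vectors with at most $s$ nonzero entries and first nonzero entry equal to $1$), $F_2=\{y\in\mathbb{R}^n:\|y\|_0\le t\}$, $F=F_1\times F_2$. Bouligand cones: for nonempty $S\subseteq\mathbb{R}^p$, $x\in S$, $T^B_S(x)$ is the set of $d$ for which there exist $\{x^k\}\subset S$, $x^k\to x$, and $\lambda_k\ge0$ with $\lambda_k(x^k-x)\to d$; $N^B_S(x)=\{d:\langle d,u\rangle\le0\ \forall u\in T^B_S(x)\}$. For $z^*\in F$: $z^*$ is $N^B$-stationary if $-\nabla f(z^* )\in N^B_F(z^* )$; $z^*$ is $T^B$-stationary if $\|\nabla^B_F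 f(z^* )\|=0$, where $\nabla^B_Ff(z^* ):=\mathrm{argmin}\{\|\nabla f(z^* )+d\|: d\in T^B_F(z^* )\}$ (i.e. the minimizer is $d=0$). *)

theory Defs
  imports "HOL-Analysis.Analysis"
begin

text \<open>
  A third-order tensor of size \<open>l \<times> m \<times> n\<close> has type \<open>real^'n^'m^'l\<close>; its entry
  \<open>a\<^sub>i\<^sub>j\<^sub>k\<close> is \<open>A $ i $ j $ k\<close>. The space of pairs \<open>z = (x, y)\<close> is the product type,
  whose norm and inner product are the Euclidean ones of dimension \<open>m + n\<close>.
\<close>

definition tensor_apply ::
    "real^'n^'m^'l \<Rightarrow> real^'m \<Rightarrow> real^'n \<Rightarrow> real^'l" where
  "tensor_apply A x y = (\<chi> i. \<Sum>j\<in>UNIV. \<Sum>k\<in>UNIV. A $ i $ j $ k * x $ j * y $ k)"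

definition objective ::
    "real^'n^'m^'l \<Rightarrow> real^'l \<Rightarrow> (real^'m) \<times> (real^'n) \<Rightarrow> real" where
  "objective A b z = 1/2 * (norm (tensor_apply A (fst z) (snd z) - b))\<^sup>2"

definition zero_norm :: "real^'m \<Rightarrow> nat" where
  "zero_norm x = card {i. x $ i \<noteq> 0}"

text \<open>
  Only meaningful for \<open>x \<noteq> 0\<close>. "First" needs a linear order on the index type; a finite linearly
  ordered type with \<open>m\<close> elements is order isomorphic to \<open>{1..m}\<close>.
\<close>

definition first_nonzero :: "real^('m::{finite,linorder}) \<Rightarrow> 'm" where
  "first_nonzero x = (LEAST i. x $ i \<noteq> 0)"

definition F1 :: "nat \<Rightarrow> (real^('m::{finite,linorder})) set" where
  "F1 s = {x. x \<noteq> 0 \<and> zero_norm x \<le> s \<and> x $ first_nonzero x = 1}"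

definition F2 :: "nat \<Rightarrow> (real^'n) set" where
  "F2 t = {y. zero_norm y \<le> t}"

definition feasible :: "nat \<Rightarrow> nat \<Rightarrow> ((real^('m::{finite,linorder})) \<times> (real^'n)) set" where
  "feasible s t = F1 s \<times> F2 t"

definition bouligand_tangent :: "'a::real_normed_vector set \<Rightarrow> 'a \<Rightarrow> 'a set" where
  "bouligand_tangent S x = {d. \<exists>X c. (\<forall>k::nat. X k \<in> S) \<and> X \<longlonglongrightarrow> x \<and>
     (\<forall>k. (c k :: real) \<ge> 0) \<and> (\<lambda>k. c k *\<^sub>R (X k - x)) \<longlonglongrightarrow> d}"

definition bouligand_normal :: "'a::real_inner set \<Rightarrow> 'a \<Rightarrow> 'a set" where
  "bouligand_normal S x = {d. \<forall>u \<in> bouligand_tangent S x. d \<bullet> u \<le> 0}"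

definition grad :: "('a::real_inner \<Rightarrow> real) \<Rightarrow> 'a \<Rightarrow> 'a" where
  "grad f z = (THE D. GDERIV f z :> D)"

text \<open>
  The tangent cone need not be convex, so the argmin defining the projected gradient is a set in
  general. Its norm being zero is read as: \<open>0\<close> is a minimizer and there is no other.
\<close>

definition bouligand_gradient :: "('a::real_inner \<Rightarrow> real) \<Rightarrow> 'a set \<Rightarrow> 'a \<Rightarrow> 'a set" where
  "bouligand_gradient f S z =
     {d. is_arg_min (\<lambda>d. norm (grad f z + d)) (\<lambda>d. d \<in> bouligand_tangent S z) d}"

definition NB_stationary :: "('a::real_inner \<Rightarrow> real) \<Rightarrow> 'a set \<Rightarrow> 'a \<Rightarrow> bool" where
  "NB_stationary f S z \<longleftrightarrow> z \<in> S \<and> - grad f z \<in> bouligand_normal S z"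

definition TB_stationary :: "('a::real_inner \<Rightarrow> real) \<Rightarrow> 'a set \<Rightarrow> 'a \<Rightarrow> bool" where
  "TB_stationary f S z \<longleftrightarrow> z \<in> S \<and> bouligand_gradient f S z = {0}"

end

theory Submission
  imports Defs
begin

text \<open>
  At a minimizer \<open>x\<close> of a differentiable \<open>f\<close> over an arbitrary set \<open>S\<close>, no Bouligand tangent
  direction descends to first order. Indeed, if feasible points \<open>X k\<close> converge to \<open>x\<close> and the
  rescaled displacements \<open>c k *\<^sub>R (X k - x)\<close> converge to \<open>d\<close>, then the nonnegative numbers
  \<open>c k * (f (X k) - f x)\<close> converge to the derivative of \<open>f\<close> at \<open>x\<close> in the direction \<open>d\<close>
  (lemma \<open>tendsto_scaled_increment\<close>), so the gradient has nonnegative inner product with \<open>d\<close>.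
  Read literally, this is normal-cone stationarity.

  Tangent-cone stationarity is a consequence of the same inequality although the cone need not be
  convex: expanding \<open>(norm (g + d))\<^sup>2\<close> at the gradient \<open>g\<close> gives at least
  \<open>(norm g)\<^sup>2 + (norm d)\<^sup>2\<close> for every tangent \<open>d\<close>, so \<open>0\<close> is the unique closest choice.

  It remains that the objective of the tensor problem has a gradient, which holds because it is a
  polynomial in the coordinates.
\<close>

text \<open>
  The factors \<open>c k\<close> may be unbounded, so the first-order error has to be
  controlled relative to the displacement: it is the bounded quantity \<open>norm (c k *\<^sub>R (X k - x))\<close>
  times a remainder quotient that vanishes at \<open>x\<close>.
\<close>

lemma tendsto_scaled_increment:
  fixes f :: "'a::real_normed_vector \<Rightarrow> real" and X :: "nat \<Rightarrow> 'a"
  assumes f: "(f has_derivative f') (at x)"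
    and X: "X \<longlonglongrightarrow> x"
    and c: "\<And>k. c k \<ge> 0"
    and d: "(\<lambda>k. c k *\<^sub>R (X k - x)) \<longlonglongrightarrow> d"
  shows "(\<lambda>k. c k * (f (X k) - f x)) \<longlonglongrightarrow> f' d"
proof -
  define q where "q y = (f y - f x - f' (y - x)) /\<^sub>R norm (y - x)" for y
  have lin: "bounded_linear f'" using f by (rule has_derivative_bounded_linear)
  interpret f': bounded_linear f' by (fact lin)
  \<comment> \<open>Division by zero yields \<open>q x = 0\<close>, which is the limit of \<open>q\<close> at \<open>x\<close>; hence indices with
    \<open>X k = x\<close> cause no trouble.\<close>
  have "isCont q x"
    using f unfolding isCont_def has_derivative_at_within q_def by simp
  then have "(\<lambda>k. q (X k)) \<longlonglongrightarrow> q x"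
    using X by (rule isCont_tendsto_compose)
  then have q: "(\<lambda>k. q (X k)) \<longlonglongrightarrow> 0" by (simp add: q_def)
  have "(\<lambda>k. f' (c k *\<^sub>R (X k - x)) + norm (c k *\<^sub>R (X k - x)) * q (X k))
          \<longlonglongrightarrow> f' d + norm d * 0"
    by (intro tendsto_intros f'.tendsto d q)
  moreover have "f' (c k *\<^sub>R (X k - x)) + norm (c k *\<^sub>R (X k - x)) * q (X k)
      = c k * (f (X k) - f x)" for k
  proof -
    have "norm (X k - x) * q (X k) = f (X k) - f x - f' (X k - x)"
      by (cases "X k = x") (auto simp: q_def f'.zero)
    then have "c k * (norm (X k - x) * q (X k)) = c k * (f (X k) - f x - f' (X k - x))"
      by simp
    then show ?thesis using c[of k] by (simp add: f'.scaleR algebra_simps del: scaleR_diff_right)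
  qed
  ultimately show ?thesis by simp
qed

lemma bouligand_tangent_derivative_nonneg:
  fixes f :: "'a::real_normed_vector \<Rightarrow> real"
  assumes f: "(f has_derivative f') (at x)"
    and min: "is_arg_min f (\<lambda>z. z \<in> S) x"
    and d: "d \<in> bouligand_tangent S x"
  shows "0 \<le> f' d"
proof -
  obtain X c where X: "\<And>k::nat. X k \<in> S" "X \<longlonglongrightarrow> x"
    and c: "\<And>k. (c k :: real) \<ge> 0" "(\<lambda>k. c k *\<^sub>R (X k - x)) \<longlonglongrightarrow> d"
    using d unfolding bouligand_tangent_def by blast
  have "(\<lambda>k. c k * (f (X k) - f x)) \<longlonglongrightarrow> f' d"
    using f X(2) c by (rule tendsto_scaled_increment)
  moreover have "0 \<le> c k * (f (X k) - f x)" for k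
    using min X(1)[of k] c(1)[of k] by (auto simp: is_arg_min_linorder)
  ultimately show ?thesis by (intro LIMSEQ_le_const) auto
qed

lemma zero_in_bouligand_tangent:
  assumes "x \<in> S"
  shows "0 \<in> bouligand_tangent S x"
  unfolding bouligand_tangent_def mem_Collect_eq
  by (rule exI[of _ "\<lambda>_. x"], rule exI[of _ "\<lambda>_. 0"]) (use assms in simp)

lemma grad_eqI:
  assumes "GDERIV f x :> g"
  shows "grad f x = g"
  unfolding grad_def
proof (rule the_equality)
  fix D assume "GDERIV f x :> D"
  then have "(\<lambda>h. h \<bullet> D) = (\<lambda>h. h \<bullet> g)"
    using assms unfolding gderiv_def by (rule has_derivative_unique)
  then show "D = g" by (metis vector_eq_ldot)
qed (fact assms)

text \<open>In finite dimension a derivative is represented by a vector, by its values on a basis.\<close>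

lemma differentiable_imp_GDERIV_grad:
  fixes f :: "'a::euclidean_space \<Rightarrow> real"
  assumes "f differentiable (at x)"
  shows "GDERIV f x :> grad f x"
proof -
  obtain f' where f': "(f has_derivative f') (at x)"
    using assms by (auto simp: differentiable_def)
  then have lin: "linear f'"
    by (rule has_derivative_linear)
  have "f' h = h \<bullet> adjoint f' 1" for h
    using adjoint_works[OF lin, of h 1] by simp
  then have "f' = (\<lambda>h. h \<bullet> adjoint f' 1)" by blast
  with f' have "GDERIV f x :> adjoint f' 1"
    by (simp add: gderiv_def)
  with grad_eqI[OF this] show ?thesis by simp
qed

lemma arg_min_imp_NB_stationary:
  fixes f :: "'a::euclidean_space \<Rightarrow> real"
  assumes "f differentiable (at x)" and min: "is_arg_min f (\<lambda>z. z \<in> S) x"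
  shows "NB_stationary f S x"
proof -
  have "(f has_derivative (\<lambda>h. h \<bullet> grad f x)) (at x)"
    using differentiable_imp_GDERIV_grad[OF assms(1)] by (simp add: gderiv_def)
  from bouligand_tangent_derivative_nonneg[OF this min] show ?thesis
    using min by (auto simp: NB_stationary_def bouligand_normal_def is_arg_min_def inner_commute)
qed

text \<open>
  For a convex cone \<open>T\<close> this would follow from the characterization of projections; for a
  nonconvex one, the sign of the inner products alone still makes \<open>0\<close> the strict minimizer.
\<close>

lemma NB_stationary_imp_TB_stationary:
  fixes f :: "'a::real_inner \<Rightarrow> real"
  assumes "NB_stationary f S x"
  shows "TB_stationary f S x"
proof -
  let ?g = "grad f x" and ?T = "bouligand_tangent S x"
  have x: "x \<in> S" using assms by (simp add: NB_stationary_def)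
  have less: "norm ?g < norm (?g + d)" if d: "d \<in> ?T" "d \<noteq> 0" for d
  proof -
    have "0 \<le> ?g \<bullet> d"
      using assms d(1) by (auto simp: NB_stationary_def bouligand_normal_def)
    moreover have "(norm (?g + d))\<^sup>2 = (norm ?g)\<^sup>2 + 2 * (?g \<bullet> d) + (norm d)\<^sup>2"
      by (simp add: power2_norm_eq_inner inner_add inner_commute)
    moreover have "0 < (norm d)\<^sup>2" using d(2) by simp
    ultimately have "(norm ?g)\<^sup>2 < (norm (?g + d))\<^sup>2" by linarith
    then show ?thesis by (rule power_less_imp_less_base) simp
  qed
  have zero: "0 \<in> ?T" using x by (rule zero_in_bouligand_tangent)
  have "is_arg_min (\<lambda>d. norm (?g + d)) (\<lambda>d. d \<in> ?T) d \<longleftrightarrow> d = 0" for d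
  proof
    assume "is_arg_min (\<lambda>d. norm (?g + d)) (\<lambda>d. d \<in> ?T) d"
    then have "d \<in> ?T" "\<not> norm ?g < norm (?g + d)"
      using zero by (force simp: is_arg_min_def)+
    with less show "d = 0" by blast
  next
    assume "d = 0"
    then show "is_arg_min (\<lambda>d. norm (?g + d)) (\<lambda>d. d \<in> ?T) d"
      using zero less by (fastforce simp: is_arg_min_def)
  qed
  then show ?thesis
    using x by (simp add: TB_stationary_def bouligand_gradient_def)
qed

lemma objective_differentiable:
  fixes A :: "real^'n^'m^'l"
  shows "objective A b differentiable (at z)"
proof -
  have comp: "(\<lambda>z. tensor_apply A (fst z) (snd z) $ i) differentiable (at z)" for i
    unfolding tensor_apply_def vec_lambda_beta
    by (intro differentiable_sum differentiable_mult differentiable_const ballI finite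
        bounded_linear_imp_differentiable
        bounded_linear_compose[OF bounded_linear_vec_nth bounded_linear_fst]
        bounded_linear_compose[OF bounded_linear_vec_nth bounded_linear_snd])
  have "objective A b =
      (\<lambda>z. 1/2 * (\<Sum>i\<in>UNIV. (tensor_apply A (fst z) (snd z) $ i - b $ i)\<^sup>2))"
    unfolding objective_def power2_norm_eq_inner inner_vec_def
    by (simp add: power2_eq_square)
  then show ?thesis
    by (simp only:) (intro differentiable_mult differentiable_const differentiable_sum
        differentiable_power differentiable_diff comp ballI finite)
qed

theorem theorem3p5:
  fixes A :: "real^'n^('m::{finite,linorder})^'l"
    and b :: "real^'l"
    and s t :: nat
    and xs :: "real^('m::{finite,linorder})"
    and ys :: "real^'n"
  assumes "1 \<le> s" and "s < CARD('m)"
    and "1 \<le> t" and "t < CARD('n)"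
    and "is_arg_min (objective A b) (\<lambda>z. z \<in> feasible s t) (xs, ys)"
  shows "NB_stationary (objective A b) (feasible s t) (xs, ys)
       \<and> TB_stationary (objective A b) (feasible s t) (xs, ys)"
  using arg_min_imp_NB_stationary[OF objective_differentiable assms(5)]
    NB_stationary_imp_TB_stationary by blast

end
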